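(* Let $R$ and $S$ be unital $2$-torsion free rings, let $M$ be a unital $2$-torsion free $(R,S)$-bimodule which is faithful as a left $R$-module and faithful as a right $S$-module, and let $T=\mathrm{Tri}(R,M,S)$ be the associated triangular ring. Let $E=T\oplus T$ be the trivial extension of $T$ by the $T$-bimodule $T$. Then every Jordan derivation from $E$ into itself is a derivation.
   Context: All rings are associative. The triangular ring $\mathrm{Tri}(R,M,S)$ is the ring of all matrices $\begin{pmatrix} r & m\\ 0 & s\end{pmatrix}$ with $r\in R$, $m\in M$, $s\in S$, under the usual matrix operations. A ring or module is $2$-torsion free if $2x=0$ implies $x=0$. Given a ring $A$ and an $A$-bimodule $N$, the trivial extension of $A$ by $N$ is the ring $A\oplus N$ with the usual (componentwise) addition and the multiplication $(a_1,n_1)(a_2,n_2)=(a_1a_2,\,a_1n_2+n_1a_2)$; here $A=N=T$ with the bimodule structure given by multiplication. An additive map $d$ on a ring $A$ is a derivation if $d(xy)=d(x)y+xd(y)$ for all $x,y\in A$. An additive map $\delta$ on $A$ is a Jordan derivation if $\delta(xy+yx)=\delta(x)y+x\delta(y)+\delta(y)x+y\delta(x)$ for all $x,y\in A$. *)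

theory Defs
  imports "HOL-Algebra.Module"
begin

section \<open>Bimodules\<close>

text \<open>
  As for the library's modules, only the additive part of the ring record underlying a
  bimodule is meaningful; its multiplicative fields are not used.
\<close>

record ('a, 'b, 'c) bimodule = "('a, 'c) module" +
  rsmult :: "['c, 'b] \<Rightarrow> 'c" (infixl \<open>\<triangleleft>\<index>\<close> 70)

text \<open>
  A unital bimodule over unital associative rings. The library's locale for modules
  is restricted to commutative rings, so it cannot be reused here.
\<close>

locale bimodule = R?: ring R + S?: ring S + M?: abelian_group M
  for R (structure) and S (structure) and M (structure) +
  assumes lsmult_closed:
      "\<lbrakk>r \<in> carrier R; x \<in> carrier M\<rbrakk> \<Longrightarrow> r \<odot>\<^bsub>M\<^esub> x \<in> carrier M"
    and lsmult_l_distr: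
      "\<lbrakk>r \<in> carrier R; r' \<in> carrier R; x \<in> carrier M\<rbrakk> \<Longrightarrow>
        (r \<oplus>\<^bsub>R\<^esub> r') \<odot>\<^bsub>M\<^esub> x = r \<odot>\<^bsub>M\<^esub> x \<oplus>\<^bsub>M\<^esub> r' \<odot>\<^bsub>M\<^esub> x"
    and lsmult_r_distr:
      "\<lbrakk>r \<in> carrier R; x \<in> carrier M; y \<in> carrier M\<rbrakk> \<Longrightarrow>
        r \<odot>\<^bsub>M\<^esub> (x \<oplus>\<^bsub>M\<^esub> y) = r \<odot>\<^bsub>M\<^esub> x \<oplus>\<^bsub>M\<^esub> r \<odot>\<^bsub>M\<^esub> y"
    and lsmult_assoc:
      "\<lbrakk>r \<in> carrier R; r' \<in> carrier R; x \<in> carrier M\<rbrakk> \<Longrightarrow>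
        (r \<otimes>\<^bsub>R\<^esub> r') \<odot>\<^bsub>M\<^esub> x = r \<odot>\<^bsub>M\<^esub> (r' \<odot>\<^bsub>M\<^esub> x)"
    and lsmult_one:
      "x \<in> carrier M \<Longrightarrow> \<one>\<^bsub>R\<^esub> \<odot>\<^bsub>M\<^esub> x = x"
    and rsmult_closed:
      "\<lbrakk>x \<in> carrier M; s \<in> carrier S\<rbrakk> \<Longrightarrow> x \<triangleleft>\<^bsub>M\<^esub> s \<in> carrier M"
    and rsmult_l_distr:
      "\<lbrakk>x \<in> carrier M; y \<in> carrier M; s \<in> carrier S\<rbrakk> \<Longrightarrow>
        (x \<oplus>\<^bsub>M\<^esub> y) \<triangleleft>\<^bsub>M\<^esub> s = x \<triangleleft>\<^bsub>M\<^esub> s \<oplus>\<^bsub>M\<^esub> y \<triangleleft>\<^bsub>M\<^esub> s"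
    and rsmult_r_distr:
      "\<lbrakk>x \<in> carrier M; s \<in> carrier S; s' \<in> carrier S\<rbrakk> \<Longrightarrow>
        x \<triangleleft>\<^bsub>M\<^esub> (s \<oplus>\<^bsub>S\<^esub> s') = x \<triangleleft>\<^bsub>M\<^esub> s \<oplus>\<^bsub>M\<^esub> x \<triangleleft>\<^bsub>M\<^esub> s'"
    and rsmult_assoc:
      "\<lbrakk>x \<in> carrier M; s \<in> carrier S; s' \<in> carrier S\<rbrakk> \<Longrightarrow>
        x \<triangleleft>\<^bsub>M\<^esub> (s \<otimes>\<^bsub>S\<^esub> s') = (x \<triangleleft>\<^bsub>M\<^esub> s) \<triangleleft>\<^bsub>M\<^esub> s'"
    and rsmult_one:
      "x \<in> carrier M \<Longrightarrow> x \<triangleleft>\<^bsub>M\<^esub> \<one>\<^bsub>S\<^esub> = x"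
    and lsmult_rsmult_assoc:
      "\<lbrakk>r \<in> carrier R; x \<in> carrier M; s \<in> carrier S\<rbrakk> \<Longrightarrow>
        (r \<odot>\<^bsub>M\<^esub> x) \<triangleleft>\<^bsub>M\<^esub> s = r \<odot>\<^bsub>M\<^esub> (x \<triangleleft>\<^bsub>M\<^esub> s)"

definition left_faithful ::
    "('a, 'x) ring_scheme \<Rightarrow> ('a, 'b, 'c, 'z) bimodule_scheme \<Rightarrow> bool" where
  "left_faithful R M \<longleftrightarrow>
    (\<forall>r\<in>carrier R. (\<forall>x\<in>carrier M. r \<odot>\<^bsub>M\<^esub> x = \<zero>\<^bsub>M\<^esub>) \<longrightarrow> r = \<zero>\<^bsub>R\<^esub>)"

definition right_faithful ::
    "('b, 'y) ring_scheme \<Rightarrow> ('a, 'b, 'c, 'z) bimodule_scheme \<Rightarrow> bool" where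
  "right_faithful S M \<longleftrightarrow>
    (\<forall>s\<in>carrier S. (\<forall>x\<in>carrier M. x \<triangleleft>\<^bsub>M\<^esub> s = \<zero>\<^bsub>M\<^esub>) \<longrightarrow> s = \<zero>\<^bsub>S\<^esub>)"

text \<open>Applies to rings and to bimodules alike, since bimodule records extend ring records.\<close>

definition two_torsion_free :: "('a, 'x) ring_scheme \<Rightarrow> bool" where
  "two_torsion_free G \<longleftrightarrow> (\<forall>x\<in>carrier G. x \<oplus>\<^bsub>G\<^esub> x = \<zero>\<^bsub>G\<^esub> \<longrightarrow> x = \<zero>\<^bsub>G\<^esub>)"

definition regular_bimodule :: "('a, 'x) ring_scheme \<Rightarrow> ('a, 'a, 'a) bimodule" where
  "regular_bimodule A =
    \<lparr>carrier = carrier A, monoid.mult = mult A, one = one A, zero = zero A, add = add A,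
     smult = mult A, rsmult = mult A\<rparr>"

lemma regular_bimodule_bimodule:
  assumes "ring A"
  shows "bimodule A A (regular_bimodule A)"
proof -
  interpret A: ring A by fact
  have "abelian_group (regular_bimodule A)"
    by (rule abelian_groupI)
      (auto simp: regular_bimodule_def A.add.m_ac intro: A.l_neg A.a_inv_closed)
  then show ?thesis
    by (intro bimodule.intro bimodule_axioms.intro)
      (auto simp: regular_bimodule_def A.l_distr A.r_distr A.m_assoc assms)
qed


section \<open>Triangular rings and trivial extensions\<close>

text \<open>
  The triple \<open>(r, m, s)\<close> stands for the upper triangular matrix with diagonal
  entries \<open>r\<close>, \<open>s\<close> and upper right entry \<open>m\<close>.
\<close>

definition Tri ::
    "('a, 'x) ring_scheme \<Rightarrow> ('a, 'b, 'c, 'z) bimodule_scheme \<Rightarrow> ('b, 'y) ring_scheme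
      \<Rightarrow> ('a \<times> 'c \<times> 'b) ring" where
  "Tri R M S =
    \<lparr>carrier = carrier R \<times> carrier M \<times> carrier S,
     monoid.mult = (\<lambda>(r, m, s) (r', m', s').
       (r \<otimes>\<^bsub>R\<^esub> r', r \<odot>\<^bsub>M\<^esub> m' \<oplus>\<^bsub>M\<^esub> m \<triangleleft>\<^bsub>M\<^esub> s', s \<otimes>\<^bsub>S\<^esub> s')),
     one = (\<one>\<^bsub>R\<^esub>, \<zero>\<^bsub>M\<^esub>, \<one>\<^bsub>S\<^esub>),
     zero = (\<zero>\<^bsub>R\<^esub>, \<zero>\<^bsub>M\<^esub>, \<zero>\<^bsub>S\<^esub>),
     add = (\<lambda>(r, m, s) (r', m', s').
       (r \<oplus>\<^bsub>R\<^esub> r', m \<oplus>\<^bsub>M\<^esub> m', s \<oplus>\<^bsub>S\<^esub> s'))\<rparr>"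

definition trivial_extension ::
    "('a, 'x) ring_scheme \<Rightarrow> ('a, 'a, 'c, 'z) bimodule_scheme \<Rightarrow> ('a \<times> 'c) ring" where
  "trivial_extension A N =
    \<lparr>carrier = carrier A \<times> carrier N,
     monoid.mult = (\<lambda>(a, n) (a', n'). (a \<otimes>\<^bsub>A\<^esub> a', a \<odot>\<^bsub>N\<^esub> n' \<oplus>\<^bsub>N\<^esub> n \<triangleleft>\<^bsub>N\<^esub> a')),
     one = (\<one>\<^bsub>A\<^esub>, \<zero>\<^bsub>N\<^esub>),
     zero = (\<zero>\<^bsub>A\<^esub>, \<zero>\<^bsub>N\<^esub>),
     add = (\<lambda>(a, n) (a', n'). (a \<oplus>\<^bsub>A\<^esub> a', n \<oplus>\<^bsub>N\<^esub> n'))\<rparr>"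

context bimodule
begin

lemma lsmult_zero: "r \<in> carrier R \<Longrightarrow> r \<odot>\<^bsub>M\<^esub> \<zero>\<^bsub>M\<^esub> = \<zero>\<^bsub>M\<^esub>"
  using lsmult_r_distr[of r "\<zero>\<^bsub>M\<^esub>" "\<zero>\<^bsub>M\<^esub>"] lsmult_closed[of r "\<zero>\<^bsub>M\<^esub>"]
  by (metis M.add.l_cancel_one' M.zero_closed M.l_zero)

lemma zero_rsmult: "s \<in> carrier S \<Longrightarrow> \<zero>\<^bsub>M\<^esub> \<triangleleft>\<^bsub>M\<^esub> s = \<zero>\<^bsub>M\<^esub>"
  using rsmult_l_distr[of "\<zero>\<^bsub>M\<^esub>" "\<zero>\<^bsub>M\<^esub>" s] rsmult_closed[of "\<zero>\<^bsub>M\<^esub>" s]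
  by (metis M.add.l_cancel_one' M.zero_closed M.l_zero)

lemmas smult_simps =
  lsmult_closed lsmult_l_distr lsmult_r_distr lsmult_assoc lsmult_one
  rsmult_closed rsmult_l_distr rsmult_r_distr rsmult_assoc rsmult_one
  lsmult_rsmult_assoc lsmult_zero zero_rsmult

lemma Tri_ring: "ring (Tri R M S)"
proof (rule ringI)
  show "abelian_group (Tri R M S)"
  proof (rule abelian_groupI)
    fix x assume "x \<in> carrier (Tri R M S)"
    then obtain r m s where x: "x = (r, m, s)"
      and c: "r \<in> carrier R" "m \<in> carrier M" "s \<in> carrier S"
      by (auto simp: Tri_def)
    show "\<exists>y\<in>carrier (Tri R M S). y \<oplus>\<^bsub>Tri R M S\<^esub> x = \<zero>\<^bsub>Tri R M S\<^esub>"
      by (rule bexI[where x = "(\<ominus>\<^bsub>R\<^esub> r, \<ominus>\<^bsub>M\<^esub> m, \<ominus>\<^bsub>S\<^esub> s)"])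
        (use c in \<open>auto simp: x Tri_def R.l_neg M.l_neg S.l_neg\<close>)
  qed (auto simp: Tri_def R.add.m_ac M.add.m_ac S.add.m_ac)
  show "monoid (Tri R M S)"
    by (rule monoidI)
      (auto simp: Tri_def smult_simps R.m_assoc S.m_assoc M.a_assoc)
qed (auto simp: Tri_def smult_simps R.l_distr S.l_distr R.r_distr S.r_distr M.add.m_ac)

end

lemma trivial_extension_ring:
  assumes "bimodule A A N"
  shows "ring (trivial_extension A N)"
proof -
  interpret bimodule A A N by fact
  show ?thesis
  proof (rule ringI)
    show "abelian_group (trivial_extension A N)"
    proof (rule abelian_groupI)
      fix x assume "x \<in> carrier (trivial_extension A N)"
      then obtain a n where x: "x = (a, n)" and c: "a \<in> carrier A" "n \<in> carrier N"
        by (auto simp: trivial_extension_def)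
      show "\<exists>y\<in>carrier (trivial_extension A N).
          y \<oplus>\<^bsub>trivial_extension A N\<^esub> x = \<zero>\<^bsub>trivial_extension A N\<^esub>"
        by (rule bexI[where x = "(\<ominus>\<^bsub>A\<^esub> a, \<ominus>\<^bsub>N\<^esub> n)"])
          (use c in \<open>auto simp: x trivial_extension_def R.l_neg M.l_neg\<close>)
    qed (auto simp: trivial_extension_def R.add.m_ac M.add.m_ac)
    show "monoid (trivial_extension A N)"
      by (rule monoidI)
        (auto simp: trivial_extension_def smult_simps R.m_assoc M.a_assoc)
  qed (auto simp: trivial_extension_def smult_simps R.l_distr R.r_distr M.add.m_ac)
qed


section \<open>Derivations\<close>

definition derivation :: "('a, 'x) ring_scheme \<Rightarrow> ('a \<Rightarrow> 'a) \<Rightarrow> bool" where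
  "derivation A d \<longleftrightarrow>
    d \<in> hom (add_monoid A) (add_monoid A) \<and>
    (\<forall>x\<in>carrier A. \<forall>y\<in>carrier A.
      d (x \<otimes>\<^bsub>A\<^esub> y) = d x \<otimes>\<^bsub>A\<^esub> y \<oplus>\<^bsub>A\<^esub> x \<otimes>\<^bsub>A\<^esub> d y)"

definition jordan_derivation :: "('a, 'x) ring_scheme \<Rightarrow> ('a \<Rightarrow> 'a) \<Rightarrow> bool" where
  "jordan_derivation A \<delta> \<longleftrightarrow>
    \<delta> \<in> hom (add_monoid A) (add_monoid A) \<and>
    (\<forall>x\<in>carrier A. \<forall>y\<in>carrier A.
      \<delta> (x \<otimes>\<^bsub>A\<^esub> y \<oplus>\<^bsub>A\<^esub> y \<otimes>\<^bsub>A\<^esub> x) =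
        \<delta> x \<otimes>\<^bsub>A\<^esub> y \<oplus>\<^bsub>A\<^esub> x \<otimes>\<^bsub>A\<^esub> \<delta> y \<oplus>\<^bsub>A\<^esub> \<delta> y \<otimes>\<^bsub>A\<^esub> x \<oplus>\<^bsub>A\<^esub> y \<otimes>\<^bsub>A\<^esub> \<delta> x)"

end

theory Submission
  imports Defs
begin

text \<open>
  The matrix unit \<open>e = diag(1, 0)\<close> is an idempotent of \<open>E\<close>, and with \<open>f = 1 - e\<close> one has
  \<open>f E e = 0\<close>, so that \<open>E\<close> is again triangular with respect to \<open>e\<close>, and \<open>e E f\<close> is
  faithful over \<open>e E e\<close> and \<open>f E f\<close>. Any Jordan derivation \<open>\<delta>\<close> of such a ring satisfies
  \<open>\<delta> e \<in> e E f\<close>, so subtracting the inner derivation \<open>x \<mapsto> [x, \<delta> e]\<close> one may assume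
  \<open>\<delta> e = 0\<close>. Then \<open>\<delta>\<close> preserves the Peirce components. As \<open>a x + x a = a x\<close> for
  \<open>a \<in> e E e\<close> and \<open>x \<in> e E f\<close>, the Leibniz rule holds for \<open>a x\<close>; expanding
  \<open>\<delta> (a b x)\<close> in two ways and cancelling \<open>x\<close> by faithfulness gives it for
  \<open>a, b \<in> e E e\<close>, and symmetrically on \<open>f E f\<close>.
\<close>

section \<open>Derivations and Jordan derivations\<close>

context ring
begin

lemma minus_eq_zero_imp_eq:
  assumes "a \<ominus> b = \<zero>" "a \<in> carrier R" "b \<in> carrier R"
  shows "a = b"
proof -
  have "a = (a \<ominus> b) \<oplus> b" using assms(2,3) by (simp add: minus_eq a_assoc l_neg)
  then show ?thesis using assms by simp
qed

lemma derivationD: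
  assumes "derivation R d"
  shows "x \<in> carrier R \<Longrightarrow> d x \<in> carrier R"
    and "x \<in> carrier R \<Longrightarrow> y \<in> carrier R \<Longrightarrow> d (x \<oplus> y) = d x \<oplus> d y"
    and "x \<in> carrier R \<Longrightarrow> y \<in> carrier R \<Longrightarrow> d (x \<otimes> y) = d x \<otimes> y \<oplus> x \<otimes> d y"
  using assms by (auto simp: derivation_def hom_def)

lemma jordan_derivationD:
  assumes "jordan_derivation R d"
  shows "x \<in> carrier R \<Longrightarrow> d x \<in> carrier R"
    and "x \<in> carrier R \<Longrightarrow> y \<in> carrier R \<Longrightarrow> d (x \<oplus> y) = d x \<oplus> d y"
    and "x \<in> carrier R \<Longrightarrow> y \<in> carrier R \<Longrightarrow>
      d (x \<otimes> y \<oplus> y \<otimes> x) = d x \<otimes> y \<oplus> x \<otimes> d y \<oplus> d y \<otimes> x \<oplus> y \<otimes> d x"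
  using assms by (auto simp: jordan_derivation_def hom_def)

lemma derivationI:
  assumes "\<And>x. x \<in> carrier R \<Longrightarrow> d x \<in> carrier R"
    and "\<And>x y. x \<in> carrier R \<Longrightarrow> y \<in> carrier R \<Longrightarrow> d (x \<oplus> y) = d x \<oplus> d y"
    and "\<And>x y. x \<in> carrier R \<Longrightarrow> y \<in> carrier R \<Longrightarrow> d (x \<otimes> y) = d x \<otimes> y \<oplus> x \<otimes> d y"
  shows "derivation R d"
  using assms by (auto simp: derivation_def hom_def)

lemma jordan_derivationI:
  assumes "\<And>x. x \<in> carrier R \<Longrightarrow> d x \<in> carrier R"
    and "\<And>x y. x \<in> carrier R \<Longrightarrow> y \<in> carrier R \<Longrightarrow> d (x \<oplus> y) = d x \<oplus> d y"
    and "\<And>x y. x \<in> carrier R \<Longrightarrow> y \<in> carrier R \<Longrightarrow>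
      d (x \<otimes> y \<oplus> y \<otimes> x) = d x \<otimes> y \<oplus> x \<otimes> d y \<oplus> d y \<otimes> x \<oplus> y \<otimes> d x"
  shows "jordan_derivation R d"
  using assms by (auto simp: jordan_derivation_def hom_def)

lemma derivation_cong:
  assumes "derivation R d" "\<And>x. x \<in> carrier R \<Longrightarrow> d' x = d x"
  shows "derivation R d'"
  by (rule derivationI) (simp_all add: derivationD[OF assms(1)] assms(2))

lemma derivation_add:
  assumes "derivation R d" "derivation R d'"
  shows "derivation R (\<lambda>x. d x \<oplus> d' x)"
  by (rule derivationI)
    (simp_all add: derivationD[OF assms(1)] derivationD[OF assms(2)] l_distr r_distr a_ac)

text \<open>A derivation satisfies the Jordan identity too, and that identity is additive in the
  map. This permits normalising a Jordan derivation by an inner derivation.\<close>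

lemma jordan_derivation_diff:
  assumes "jordan_derivation R \<delta>" "derivation R d"
  shows "jordan_derivation R (\<lambda>x. \<delta> x \<ominus> d x)"
proof (rule jordan_derivationI)
  note [simp] = jordan_derivationD(1)[OF assms(1)] derivationD(1)[OF assms(2)]
  note minus_simps = minus_eq minus_add l_minus r_minus l_distr r_distr a_ac
  fix x y assume xy: "x \<in> carrier R" "y \<in> carrier R"
  show "\<delta> (x \<otimes> y \<oplus> y \<otimes> x) \<ominus> d (x \<otimes> y \<oplus> y \<otimes> x) =
      (\<delta> x \<ominus> d x) \<otimes> y \<oplus> x \<otimes> (\<delta> y \<ominus> d y) \<oplus> (\<delta> y \<ominus> d y) \<otimes> x \<oplus> y \<otimes> (\<delta> x \<ominus> d x)"
    using xy unfolding jordan_derivationD(3)[OF assms(1) xy]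
    by (simp add: derivationD(2,3)[OF assms(2)] minus_simps)
  show "\<delta> (x \<oplus> y) \<ominus> d (x \<oplus> y) = \<delta> x \<ominus> d x \<oplus> (\<delta> y \<ominus> d y)"
    using xy
    by (simp add: jordan_derivationD(2)[OF assms(1)] derivationD(2)[OF assms(2)] minus_simps)
qed (simp add: jordan_derivationD(1)[OF assms(1)] derivationD(1)[OF assms(2)])

lemma derivation_inner:
  assumes m: "m \<in> carrier R"
  shows "derivation R (\<lambda>x. x \<otimes> m \<ominus> m \<otimes> x)"
proof (rule derivationI)
  fix x y assume xy: "x \<in> carrier R" "y \<in> carrier R"
  \<comment> \<open>The terms \<open>x m y\<close> of opposite sign are kept on the right, so that
    both sides expand to the same sum up to associativity and commutativity; they cancel only
    afterwards.\<close>
  have "(x \<otimes> m \<ominus> m \<otimes> x) \<otimes> y \<oplus> x \<otimes> (y \<otimes> m \<ominus> m \<otimes> y) =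
      (x \<otimes> m \<otimes> y \<ominus> x \<otimes> m \<otimes> y) \<oplus> (x \<otimes> y \<otimes> m \<ominus> m \<otimes> (x \<otimes> y))"
    using xy m by (simp add: minus_eq minus_add l_minus r_minus l_distr r_distr a_ac m_assoc)
  then show "x \<otimes> y \<otimes> m \<ominus> m \<otimes> (x \<otimes> y) =
      (x \<otimes> m \<ominus> m \<otimes> x) \<otimes> y \<oplus> x \<otimes> (y \<otimes> m \<ominus> m \<otimes> y)"
    using xy m by (simp add: minus_eq r_neg)
qed (use m in \<open>simp_all add: minus_eq minus_add l_distr r_distr a_ac\<close>)

end


section \<open>Rings that are triangular with respect to an idempotent\<close>

text \<open>The corners are given by equations inside a single ring, which makes the argument
  independent of the encoding of matrices and of trivial extensions.\<close>

locale triangular_idempotent = ring +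
  fixes e f
  assumes e_closed [simp]: "e \<in> carrier R" and f_closed [simp]: "f \<in> carrier R"
    and e_add_f: "e \<oplus> f = \<one>"
    and ee [simp]: "e \<otimes> e = e" and ff [simp]: "f \<otimes> f = f"
    and ef [simp]: "e \<otimes> f = \<zero>" and fe [simp]: "f \<otimes> e = \<zero>"
    and corner: "x \<in> carrier R \<Longrightarrow> f \<otimes> (x \<otimes> e) = \<zero>"
    and two_torsion_free: "x \<in> carrier R \<Longrightarrow> x \<oplus> x = \<zero> \<Longrightarrow> x = \<zero>"
    and left_faithful: "\<lbrakk>a \<in> carrier R; e \<otimes> a = a; a \<otimes> e = a;
      \<And>x. \<lbrakk>x \<in> carrier R; e \<otimes> x = x; x \<otimes> f = x\<rbrakk> \<Longrightarrow> a \<otimes> x = \<zero>\<rbrakk> \<Longrightarrow> a = \<zero>"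
    and right_faithful: "\<lbrakk>c \<in> carrier R; f \<otimes> c = c; c \<otimes> f = c;
      \<And>x. \<lbrakk>x \<in> carrier R; e \<otimes> x = x; x \<otimes> f = x\<rbrakk> \<Longrightarrow> x \<otimes> c = \<zero>\<rbrakk> \<Longrightarrow> c = \<zero>"
begin

section \<open>Peirce decomposition with respect to \<open>e\<close> and \<open>f\<close>\<close>

definition "A11 = {x \<in> carrier R. e \<otimes> x = x \<and> x \<otimes> e = x}"
definition "A12 = {x \<in> carrier R. e \<otimes> x = x \<and> x \<otimes> f = x}"
definition "A22 = {x \<in> carrier R. f \<otimes> x = x \<and> x \<otimes> f = x}"

lemmas peirce_defs = A11_def A12_def A22_def

text \<open>Once \<open>m_assoc\<close> has nested products to the right, \<open>ee\<close> and its
  companions no longer match inside them; these variants do.\<close>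

lemma
  assumes "x \<in> carrier R"
  shows ee': "e \<otimes> (e \<otimes> x) = e \<otimes> x" and ff': "f \<otimes> (f \<otimes> x) = f \<otimes> x"
    and ef': "e \<otimes> (f \<otimes> x) = \<zero>" and fe': "f \<otimes> (e \<otimes> x) = \<zero>"
  using assms by (simp_all flip: m_assoc)

lemmas peirce_simps = ee' ff' ef' fe' corner m_assoc

text \<open>Expanding \<open>(e + f) x (e + f)\<close> gives four terms, and \<open>f x e\<close>
  vanishes by \<open>corner\<close>.\<close>

lemma peirce_decomp:
  assumes x: "x \<in> carrier R"
  shows "x = e \<otimes> (x \<otimes> e) \<oplus> e \<otimes> (x \<otimes> f) \<oplus> f \<otimes> (x \<otimes> f)"
proof -
  have "x = (e \<oplus> f) \<otimes> (x \<otimes> (e \<oplus> f))"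
    using x by (simp add: e_add_f)
  also have "\<dots> = e \<otimes> (x \<otimes> e) \<oplus> e \<otimes> (x \<otimes> f) \<oplus> f \<otimes> (x \<otimes> f)"
    using x by (simp add: l_distr r_distr corner a_ac)
  finally show ?thesis .
qed

lemma peirce_components:
  assumes "x \<in> carrier R"
  shows "e \<otimes> (x \<otimes> e) \<in> A11" "e \<otimes> (x \<otimes> f) \<in> A12" "f \<otimes> (x \<otimes> f) \<in> A22"
  using assms by (simp_all add: peirce_defs peirce_simps)

lemma peirce_cases:
  assumes "x \<in> carrier R"
  obtains a p c where "a \<in> A11" "p \<in> A12" "c \<in> A22" "x = a \<oplus> p \<oplus> c"
  using peirce_decomp[OF assms] peirce_components[OF assms] by blast

lemma peirce_carrier:
  "x \<in> A11 \<Longrightarrow> x \<in> carrier R" "x \<in> A12 \<Longrightarrow> x \<in> carrier R" "x \<in> A22 \<Longrightarrow> x \<in> carrier R"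
  by (auto simp: peirce_defs)

lemma mult_zeroI:
  assumes "x \<in> carrier R" "y \<in> carrier R" "u \<in> carrier R" "v \<in> carrier R"
    and "x \<otimes> u = x" "v \<otimes> y = y" "u \<otimes> v = \<zero>"
  shows "x \<otimes> y = \<zero>"
proof -
  have "x \<otimes> y = (x \<otimes> u) \<otimes> (v \<otimes> y)" using assms by simp
  also have "\<dots> = x \<otimes> (u \<otimes> v) \<otimes> y" using assms(1-4) by (simp add: m_assoc)
  finally show ?thesis using assms by simp
qed

text \<open>In each case the inner idempotents meet as \<open>e f\<close> or \<open>f e\<close>. Of
  the nine products of components only the four in \<open>peirce_mult\<close> survive.\<close>

lemma peirce_orthogonal:
  "x \<in> A11 \<Longrightarrow> y \<in> A22 \<Longrightarrow> x \<otimes> y = \<zero>"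
  "x \<in> A12 \<Longrightarrow> y \<in> A11 \<Longrightarrow> x \<otimes> y = \<zero>"
  "x \<in> A12 \<Longrightarrow> y \<in> A12 \<Longrightarrow> x \<otimes> y = \<zero>"
  "x \<in> A22 \<Longrightarrow> y \<in> A11 \<Longrightarrow> x \<otimes> y = \<zero>"
  "x \<in> A22 \<Longrightarrow> y \<in> A12 \<Longrightarrow> x \<otimes> y = \<zero>"
  using mult_zeroI[of x y e f] mult_zeroI[of x y f e] by (simp_all add: peirce_defs)

lemma peirce_mult:
  "x \<in> A11 \<Longrightarrow> y \<in> A11 \<Longrightarrow> x \<otimes> y \<in> A11"
  "x \<in> A11 \<Longrightarrow> y \<in> A12 \<Longrightarrow> x \<otimes> y \<in> A12"
  "x \<in> A12 \<Longrightarrow> y \<in> A22 \<Longrightarrow> x \<otimes> y \<in> A12"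
  "x \<in> A22 \<Longrightarrow> y \<in> A22 \<Longrightarrow> x \<otimes> y \<in> A22"
  unfolding peirce_defs by (auto simp: m_assoc) (auto simp flip: m_assoc)

text \<open>The difference \<open>a - b\<close> satisfies the equations of \<open>A11\<close> and
  annihilates \<open>A12\<close> from the left, so \<open>left_faithful\<close> applies.\<close>

lemma A11_eqI:
  assumes "a \<in> A11" "b \<in> A11" "\<And>x. x \<in> A12 \<Longrightarrow> a \<otimes> x = b \<otimes> x"
  shows "a = b"
proof -
  have "a \<ominus> b = \<zero>"
    by (rule left_faithful)
      (use assms in \<open>auto simp: peirce_defs minus_eq l_distr r_distr l_minus r_minus r_neg\<close>)
  then show ?thesis using assms by (simp add: minus_eq_zero_imp_eq peirce_carrier)
qed

lemma A22_eqI: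
  assumes "a \<in> A22" "b \<in> A22" "\<And>x. x \<in> A12 \<Longrightarrow> x \<otimes> a = x \<otimes> b"
  shows "a = b"
proof -
  have "a \<ominus> b = \<zero>"
    by (rule right_faithful)
      (use assms in \<open>auto simp: peirce_defs minus_eq l_distr r_distr l_minus r_minus r_neg\<close>)
  then show ?thesis using assms by (simp add: minus_eq_zero_imp_eq peirce_carrier)
qed

text \<open>The Jordan identity at the pair \<open>e\<close>, \<open>e\<close> reads
  \<open>2y = 2(y e + e y)\<close> for \<open>y = \<delta> e\<close>. Compressing by
  \<open>e\<close> on both sides gives \<open>2 e y e = 4 e y e\<close>, compressing by
  \<open>f\<close> gives \<open>2 f y f = 0\<close>; absence of 2-torsion leaves only
  \<open>e y f\<close>.\<close>

lemma jordan_derivation_idempotent: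
  assumes \<delta>: "jordan_derivation R \<delta>"
  shows "\<delta> e \<in> A12"
proof -
  define y where "y = \<delta> e"
  note D = jordan_derivationD[OF \<delta>]
  have y [simp]: "y \<in> carrier R" by (simp add: y_def D)
  have eq: "y \<oplus> y = y \<otimes> e \<oplus> e \<otimes> y \<oplus> y \<otimes> e \<oplus> e \<otimes> y"
    using D(3)[of e e] by (simp add: D(2) y_def)
  have "e \<otimes> (y \<oplus> y) \<otimes> e = e \<otimes> (y \<otimes> e \<oplus> e \<otimes> y \<oplus> y \<otimes> e \<oplus> e \<otimes> y) \<otimes> e"
    by (simp only: eq)
  then have "e \<otimes> (y \<otimes> e) \<oplus> e \<otimes> (y \<otimes> e) =
      (e \<otimes> (y \<otimes> e) \<oplus> e \<otimes> (y \<otimes> e)) \<oplus> (e \<otimes> (y \<otimes> e) \<oplus> e \<otimes> (y \<otimes> e))"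
    by (simp add: peirce_simps l_distr r_distr a_assoc)
  then have 1: "e \<otimes> (y \<otimes> e) = \<zero>"
    using two_torsion_free[of "e \<otimes> (y \<otimes> e)"] by simp
  have "f \<otimes> (y \<oplus> y) \<otimes> f = f \<otimes> (y \<otimes> e \<oplus> e \<otimes> y \<oplus> y \<otimes> e \<oplus> e \<otimes> y) \<otimes> f"
    by (simp only: eq)
  then have 2: "f \<otimes> (y \<otimes> f) = \<zero>"
    using two_torsion_free[of "f \<otimes> (y \<otimes> f)"] by (simp add: peirce_simps l_distr r_distr)
  have "y = e \<otimes> (y \<otimes> f)"
    using peirce_decomp[of y] by (simp add: 1 2)
  then show ?thesis
    using peirce_components(2)[OF y] by (metis y_def)
qed

section \<open>Jordan derivations that vanish at \<open>e\<close>\<close>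

context
  fixes \<delta>
  assumes \<delta>: "jordan_derivation R \<delta>" and \<delta>_e: "\<delta> e = \<zero>"
begin

lemmas D = jordan_derivationD[OF \<delta>]

text \<open>The two terms containing \<open>\<delta> e\<close> drop out. Compressing this equation
  by \<open>e\<close> and \<open>f\<close> on either side locates \<open>\<delta> x\<close> for
  \<open>x\<close> in each component.\<close>

lemma jordan_idempotent:
  assumes "x \<in> carrier R"
  shows "\<delta> (x \<otimes> e \<oplus> e \<otimes> x) = \<delta> x \<otimes> e \<oplus> e \<otimes> \<delta> x"
  using assms by (simp add: D(3) D(1) \<delta>_e)

text \<open>Here \<open>x e + e x = 2x\<close>, so \<open>2y = y e + e y\<close>. The compression
  \<open>e _ f\<close> gives \<open>2 e y f = e y f\<close>, and \<open>f _ f\<close> gives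
  \<open>2 f y f = 0\<close>.\<close>

lemma jordan_A11:
  assumes x: "x \<in> A11"
  shows "\<delta> x \<in> A11"
proof -
  define y where "y = \<delta> x"
  have y [simp]: "y \<in> carrier R" using x by (simp add: y_def D peirce_carrier)
  have eq: "y \<oplus> y = y \<otimes> e \<oplus> e \<otimes> y"
    using jordan_idempotent[of x] x by (simp add: A11_def D(2) y_def)
  have "e \<otimes> (y \<oplus> y) \<otimes> f = e \<otimes> (y \<otimes> e \<oplus> e \<otimes> y) \<otimes> f" by (simp only: eq)
  then have 1: "e \<otimes> (y \<otimes> f) = \<zero>" by (simp add: peirce_simps l_distr r_distr)
  have "f \<otimes> (y \<oplus> y) \<otimes> f = f \<otimes> (y \<otimes> e \<oplus> e \<otimes> y) \<otimes> f" by (simp only: eq)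
  then have 2: "f \<otimes> (y \<otimes> f) = \<zero>"
    using two_torsion_free[of "f \<otimes> (y \<otimes> f)"] by (simp add: peirce_simps l_distr r_distr)
  have "y = e \<otimes> (y \<otimes> e)"
    using peirce_decomp[of y] by (simp add: 1 2)
  then show ?thesis
    using peirce_components(1)[OF y] by (metis y_def)
qed

text \<open>Here \<open>x e + e x = x\<close>, so \<open>y = y e + e y\<close>; hence
  \<open>e y e = 2 e y e\<close> and \<open>f y f = 0\<close>.\<close>

lemma jordan_A12:
  assumes x: "x \<in> A12"
  shows "\<delta> x \<in> A12"
proof -
  define y where "y = \<delta> x"
  have y [simp]: "y \<in> carrier R" using x by (simp add: y_def D peirce_carrier)
  have "x \<otimes> e = \<zero>"
    using x by (intro mult_zeroI[of x e f e]) (auto simp: A12_def)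
  then have eq: "y = y \<otimes> e \<oplus> e \<otimes> y"
    using jordan_idempotent[of x] x by (simp add: A12_def y_def)
  \<comment> \<open>The equation is used from right to left, since rewriting \<open>y\<close> by a
    sum containing \<open>y\<close> would loop.\<close>
  have "e \<otimes> y \<otimes> e = e \<otimes> (y \<otimes> e \<oplus> e \<otimes> y) \<otimes> e" by (simp only: eq[symmetric])
  then have 1: "e \<otimes> (y \<otimes> e) = \<zero>" by (simp add: peirce_simps l_distr r_distr)
  have "f \<otimes> y \<otimes> f = f \<otimes> (y \<otimes> e \<oplus> e \<otimes> y) \<otimes> f" by (simp only: eq[symmetric])
  then have 2: "f \<otimes> (y \<otimes> f) = \<zero>" by (simp add: peirce_simps l_distr r_distr)
  have "y = e \<otimes> (y \<otimes> f)"
    using peirce_decomp[of y] by (simp add: 1 2)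
  then show ?thesis
    using peirce_components(2)[OF y] by (metis y_def)
qed

text \<open>Here \<open>x e + e x = 0\<close>, so \<open>y e + e y = 0\<close>; hence
  \<open>2 e y e = 0\<close> and \<open>e y f = 0\<close>.\<close>

lemma jordan_A22:
  assumes x: "x \<in> A22"
  shows "\<delta> x \<in> A22"
proof -
  define y where "y = \<delta> x"
  have y [simp]: "y \<in> carrier R" using x by (simp add: y_def D peirce_carrier)
  have "x \<otimes> e = \<zero>" "e \<otimes> x = \<zero>"
    using x by (auto simp: A22_def intro: mult_zeroI[of x e f e] mult_zeroI[of e x e f])
  moreover have "\<delta> \<zero> = \<zero>"
    using D(2)[of \<zero> \<zero>] D(1)[of \<zero>] by simp
  ultimately have eq: "y \<otimes> e \<oplus> e \<otimes> y = \<zero>"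
    using jordan_idempotent[of x] x by (simp add: A22_def y_def)
  have "e \<otimes> (y \<otimes> e \<oplus> e \<otimes> y) \<otimes> e = \<zero>" by (simp add: eq)
  then have 1: "e \<otimes> (y \<otimes> e) = \<zero>"
    using two_torsion_free[of "e \<otimes> (y \<otimes> e)"] by (simp add: peirce_simps l_distr r_distr)
  have "e \<otimes> (y \<otimes> e \<oplus> e \<otimes> y) \<otimes> f = \<zero>" by (simp add: eq)
  then have 2: "e \<otimes> (y \<otimes> f) = \<zero>" by (simp add: peirce_simps l_distr r_distr)
  have "y = f \<otimes> (y \<otimes> f)"
    using peirce_decomp[of y] by (simp add: 1 2)
  then show ?thesis
    using peirce_components(3)[OF y] by (metis y_def)
qed

section \<open>Leibniz rule on products of Peirce components\<close>

lemmas jordan_peirce = jordan_A11 jordan_A12 jordan_A22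

text \<open>The reversed product \<open>x a\<close> is zero, and so are \<open>\<delta> x a\<close>
  and \<open>x \<delta> a\<close>, because \<open>\<delta>\<close> keeps \<open>a\<close> and
  \<open>x\<close> in their components. The Jordan identity thus shrinks to the Leibniz
  rule.\<close>

lemma leibniz_A11_A12:
  assumes "a \<in> A11" "x \<in> A12"
  shows "\<delta> (a \<otimes> x) = \<delta> a \<otimes> x \<oplus> a \<otimes> \<delta> x"
  using D(3)[of a x] assms
  by (simp add: peirce_carrier jordan_peirce peirce_orthogonal)

lemma leibniz_A12_A22:
  assumes "x \<in> A12" "c \<in> A22"
  shows "\<delta> (x \<otimes> c) = \<delta> x \<otimes> c \<oplus> x \<otimes> \<delta> c"
  using D(3)[of x c] assms
  by (simp add: peirce_carrier jordan_peirce peirce_orthogonal)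

lemma leibniz_A11:
  assumes a: "a \<in> A11" and b: "b \<in> A11"
  shows "\<delta> (a \<otimes> b) = \<delta> a \<otimes> b \<oplus> a \<otimes> \<delta> b"
proof (rule A11_eqI)
  show "\<delta> (a \<otimes> b) \<in> A11" using a b by (simp add: jordan_peirce peirce_mult)
  have "\<delta> a \<otimes> b \<in> A11" "a \<otimes> \<delta> b \<in> A11"
    using a b by (simp_all add: jordan_peirce peirce_mult)
  then show "\<delta> a \<otimes> b \<oplus> a \<otimes> \<delta> b \<in> A11" by (auto simp: A11_def l_distr r_distr)
next
  fix x assume x: "x \<in> A12"
  note [simp] = peirce_carrier(1)[OF a] peirce_carrier(1)[OF b] peirce_carrier(2)[OF x] D(1)
  \<comment> \<open>First expansion: the product is read as \<open>(a b) x\<close> with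
    \<open>a b\<close> in \<open>A11\<close>.\<close>
  have "\<delta> (a \<otimes> b) \<otimes> x \<oplus> a \<otimes> (b \<otimes> \<delta> x) = \<delta> (a \<otimes> (b \<otimes> x))"
    using leibniz_A11_A12[OF peirce_mult(1)[OF a b] x] by (simp add: m_assoc)
  \<comment> \<open>Second expansion: the product is read as \<open>a (b x)\<close> with
    \<open>b x\<close> in \<open>A12\<close>.\<close>
  also have "\<dots> = \<delta> a \<otimes> (b \<otimes> x) \<oplus> a \<otimes> (\<delta> b \<otimes> x \<oplus> b \<otimes> \<delta> x)"
    using a b x by (simp add: leibniz_A11_A12 peirce_mult)
  also have "\<dots> = (\<delta> a \<otimes> b \<oplus> a \<otimes> \<delta> b) \<otimes> x \<oplus> a \<otimes> (b \<otimes> \<delta> x)"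
    by (simp add: l_distr r_distr m_assoc a_assoc)
  finally show "\<delta> (a \<otimes> b) \<otimes> x = (\<delta> a \<otimes> b \<oplus> a \<otimes> \<delta> b) \<otimes> x"
    by simp
qed

lemma leibniz_A22:
  assumes a: "a \<in> A22" and b: "b \<in> A22"
  shows "\<delta> (a \<otimes> b) = \<delta> a \<otimes> b \<oplus> a \<otimes> \<delta> b"
proof (rule A22_eqI)
  show "\<delta> (a \<otimes> b) \<in> A22" using a b by (simp add: jordan_peirce peirce_mult)
  have "\<delta> a \<otimes> b \<in> A22" "a \<otimes> \<delta> b \<in> A22"
    using a b by (simp_all add: jordan_peirce peirce_mult)
  then show "\<delta> a \<otimes> b \<oplus> a \<otimes> \<delta> b \<in> A22" by (auto simp: A22_def l_distr r_distr)
next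
  fix x assume x: "x \<in> A12"
  note [simp] = peirce_carrier(3)[OF a] peirce_carrier(3)[OF b] peirce_carrier(2)[OF x] D(1)
  have "\<delta> x \<otimes> (a \<otimes> b) \<oplus> x \<otimes> \<delta> (a \<otimes> b) = \<delta> (x \<otimes> a \<otimes> b)"
    using leibniz_A12_A22[OF x peirce_mult(4)[OF a b]] by (simp add: m_assoc)
  also have "\<dots> = (\<delta> x \<otimes> a \<oplus> x \<otimes> \<delta> a) \<otimes> b \<oplus> x \<otimes> a \<otimes> \<delta> b"
    using a b x by (simp only: leibniz_A12_A22 peirce_mult)
  also have "\<dots> = \<delta> x \<otimes> (a \<otimes> b) \<oplus> x \<otimes> (\<delta> a \<otimes> b \<oplus> a \<otimes> \<delta> b)"
    by (simp add: l_distr r_distr m_assoc a_assoc)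
  finally show "x \<otimes> \<delta> (a \<otimes> b) = x \<otimes> (\<delta> a \<otimes> b \<oplus> a \<otimes> \<delta> b)"
    by simp
qed

lemma derivation_if_idempotent_zero: "derivation R \<delta>"
proof (rule derivationI)
  fix x y assume x: "x \<in> carrier R" and y: "y \<in> carrier R"
  obtain a p c where a: "a \<in> A11" "p \<in> A12" "c \<in> A22" "x = a \<oplus> p \<oplus> c"
    using peirce_cases[OF x] .
  obtain b q d where b: "b \<in> A11" "q \<in> A12" "d \<in> A22" "y = b \<oplus> q \<oplus> d"
    using peirce_cases[OF y] .
  note [simp] = peirce_carrier(1)[OF a(1)] peirce_carrier(2)[OF a(2)] peirce_carrier(3)[OF a(3)]
    peirce_carrier(1)[OF b(1)] peirce_carrier(2)[OF b(2)] peirce_carrier(3)[OF b(3)] D(1)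
  note ab = a(1-3) b(1-3)
  have "x \<otimes> y = a \<otimes> b \<oplus> a \<otimes> q \<oplus> p \<otimes> d \<oplus> c \<otimes> d"
    using ab by (simp add: a(4) b(4) l_distr r_distr peirce_orthogonal a_assoc)
  then have "\<delta> (x \<otimes> y) = (\<delta> a \<otimes> b \<oplus> a \<otimes> \<delta> b) \<oplus> (\<delta> a \<otimes> q \<oplus> a \<otimes> \<delta> q)
      \<oplus> (\<delta> p \<otimes> d \<oplus> p \<otimes> \<delta> d) \<oplus> (\<delta> c \<otimes> d \<oplus> c \<otimes> \<delta> d)"
    using ab
    by (simp add: D(2) leibniz_A11 leibniz_A11_A12 leibniz_A12_A22 leibniz_A22)
  \<comment> \<open>Since \<open>\<delta>\<close> preserves components, orthogonality also removes
    the mixed products containing values of \<open>\<delta>\<close>, leaving exactly the eight terms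
    above.\<close>
  also have "\<dots> = \<delta> x \<otimes> y \<oplus> x \<otimes> \<delta> y"
    using ab
    by (simp add: a(4) b(4) D(2) l_distr r_distr peirce_orthogonal jordan_peirce a_ac)
  finally show "\<delta> (x \<otimes> y) = \<delta> x \<otimes> y \<oplus> x \<otimes> \<delta> y" .
qed (simp_all add: D)

end

theorem jordan_derivation_imp_derivation:
  assumes \<delta>: "jordan_derivation R \<delta>"
  shows "derivation R \<delta>"
proof -
  define m where "m = \<delta> e"
  have m: "m \<in> A12" unfolding m_def by (rule jordan_derivation_idempotent[OF \<delta>])
  note [simp] = peirce_carrier(2)[OF m]
  define d where "d = (\<lambda>x. x \<otimes> m \<ominus> m \<otimes> x)"
  have d: "derivation R d" unfolding d_def by (rule derivation_inner) simp
  \<comment> \<open>As \<open>m\<close> lies in \<open>A12\<close>, \<open>e m = m\<close> and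
    \<open>m e = 0\<close>, so \<open>d e = m = \<delta> e\<close>; this fixes the sign in the
    choice of \<open>d\<close>.\<close>
  have "m \<otimes> e = \<zero>"
    using m by (intro mult_zeroI[of m e f e]) (auto simp: A12_def)
  then have "\<delta> e \<ominus> d e = \<zero>"
    using m by (simp add: d_def A12_def flip: m_def) (simp add: minus_eq r_neg)
  then have "derivation R (\<lambda>x. \<delta> x \<ominus> d x)"
    by (intro derivation_if_idempotent_zero jordan_derivation_diff \<delta> d)
  from derivation_add[OF this d] show ?thesis
  proof (rule derivation_cong)
    fix x assume "x \<in> carrier R"
    then show "\<delta> x = \<delta> x \<ominus> d x \<oplus> d x"
      using jordan_derivationD(1)[OF \<delta>] derivationD(1)[OF d]
      by (simp add: minus_eq a_assoc l_neg)
  qed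
qed

end


section \<open>The trivial extension of a triangular ring\<close>

context bimodule
begin

lemma zero_lsmult: "x \<in> carrier M \<Longrightarrow> \<zero>\<^bsub>R\<^esub> \<odot>\<^bsub>M\<^esub> x = \<zero>\<^bsub>M\<^esub>"
  using lsmult_l_distr[of "\<zero>\<^bsub>R\<^esub>" "\<zero>\<^bsub>R\<^esub>" x] lsmult_closed[of "\<zero>\<^bsub>R\<^esub>" x]
  by (metis M.add.l_cancel_one' R.zero_closed R.l_zero)

lemma rsmult_zero: "x \<in> carrier M \<Longrightarrow> x \<triangleleft>\<^bsub>M\<^esub> \<zero>\<^bsub>S\<^esub> = \<zero>\<^bsub>M\<^esub>"
  using rsmult_r_distr[of x "\<zero>\<^bsub>S\<^esub>" "\<zero>\<^bsub>S\<^esub>"] rsmult_closed[of x "\<zero>\<^bsub>S\<^esub>"]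
  by (metis M.add.l_cancel_one' S.zero_closed S.l_zero)

text \<open>Both idempotents sit in the first copy of \<open>T\<close>. They cut each copy into its
  matrix entries, so every corner of \<open>E\<close> is a pair of copies of \<open>R\<close>,
  \<open>M\<close> or \<open>S\<close>.\<close>

lemma triangular_idempotent_trivial_extension:
  assumes "two_torsion_free R" "two_torsion_free S" "two_torsion_free M"
    and "left_faithful R M" "right_faithful S M"
  shows "triangular_idempotent (trivial_extension (Tri R M S) (regular_bimodule (Tri R M S)))
    ((\<one>\<^bsub>R\<^esub>, \<zero>\<^bsub>M\<^esub>, \<zero>\<^bsub>S\<^esub>), \<zero>\<^bsub>Tri R M S\<^esub>) ((\<zero>\<^bsub>R\<^esub>, \<zero>\<^bsub>M\<^esub>, \<one>\<^bsub>S\<^esub>), \<zero>\<^bsub>Tri R M S\<^esub>)"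
    (is "triangular_idempotent ?E ?e ?f")
proof -
  note defs = trivial_extension_def regular_bimodule_def Tri_def
  note sm = smult_simps zero_lsmult rsmult_zero
  have ring: "ring ?E"
    by (intro trivial_extension_ring regular_bimodule_bimodule Tri_ring)
  \<comment> \<open>Test elements for faithfulness. Multiplying the pair \<open>(r, r')\<close> by
    one with entry \<open>x\<close> yields the entries \<open>r x\<close> and \<open>r' x\<close>,
    so an \<open>x\<close> in the first copy alone detects both coordinates.\<close>
  have offdiag: "((\<zero>\<^bsub>R\<^esub>, x, \<zero>\<^bsub>S\<^esub>), \<zero>\<^bsub>Tri R M S\<^esub>) \<in> carrier ?E"
    "?e \<otimes>\<^bsub>?E\<^esub> ((\<zero>\<^bsub>R\<^esub>, x, \<zero>\<^bsub>S\<^esub>), \<zero>\<^bsub>Tri R M S\<^esub>) = ((\<zero>\<^bsub>R\<^esub>, x, \<zero>\<^bsub>S\<^esub>), \<zero>\<^bsub>Tri R M S\<^esub>)"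
    "((\<zero>\<^bsub>R\<^esub>, x, \<zero>\<^bsub>S\<^esub>), \<zero>\<^bsub>Tri R M S\<^esub>) \<otimes>\<^bsub>?E\<^esub> ?f = ((\<zero>\<^bsub>R\<^esub>, x, \<zero>\<^bsub>S\<^esub>), \<zero>\<^bsub>Tri R M S\<^esub>)"
    if "x \<in> carrier M" for x
    using that by (simp_all add: defs sm)
  show ?thesis
  proof (intro triangular_idempotent.intro triangular_idempotent_axioms.intro ring)
    fix x assume x: "x \<in> carrier ?E" "x \<oplus>\<^bsub>?E\<^esub> x = \<zero>\<^bsub>?E\<^esub>"
    then show "x = \<zero>\<^bsub>?E\<^esub>"
      using assms(1-3) by (auto simp: defs two_torsion_free_def)
  next
    fix a
    assume a: "a \<in> carrier ?E" "?e \<otimes>\<^bsub>?E\<^esub> a = a" "a \<otimes>\<^bsub>?E\<^esub> ?e = a"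
      and ann: "\<And>x. \<lbrakk>x \<in> carrier ?E; ?e \<otimes>\<^bsub>?E\<^esub> x = x; x \<otimes>\<^bsub>?E\<^esub> ?f = x\<rbrakk>
        \<Longrightarrow> a \<otimes>\<^bsub>?E\<^esub> x = \<zero>\<^bsub>?E\<^esub>"
    \<comment> \<open>The equations \<open>e a = a = a e\<close> force all entries of both matrices
      to vanish except the upper left ones.\<close>
    from a obtain r r' where r: "r \<in> carrier R" "r' \<in> carrier R"
      and a_eq: "a = ((r, \<zero>\<^bsub>M\<^esub>, \<zero>\<^bsub>S\<^esub>), (r', \<zero>\<^bsub>M\<^esub>, \<zero>\<^bsub>S\<^esub>))"
      by (auto simp: defs sm)
    have "r \<odot>\<^bsub>M\<^esub> x = \<zero>\<^bsub>M\<^esub> \<and> r' \<odot>\<^bsub>M\<^esub> x = \<zero>\<^bsub>M\<^esub>" if x: "x \<in> carrier M" for x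
      using ann[OF offdiag[OF x]] x r by (simp add: a_eq defs sm)
    then have "r = \<zero>\<^bsub>R\<^esub>" "r' = \<zero>\<^bsub>R\<^esub>"
      using assms(4) r unfolding left_faithful_def by blast+
    then show "a = \<zero>\<^bsub>?E\<^esub>"
      by (simp add: a_eq defs)
  next
    fix c
    assume c: "c \<in> carrier ?E" "?f \<otimes>\<^bsub>?E\<^esub> c = c" "c \<otimes>\<^bsub>?E\<^esub> ?f = c"
      and ann: "\<And>x. \<lbrakk>x \<in> carrier ?E; ?e \<otimes>\<^bsub>?E\<^esub> x = x; x \<otimes>\<^bsub>?E\<^esub> ?f = x\<rbrakk>
        \<Longrightarrow> x \<otimes>\<^bsub>?E\<^esub> c = \<zero>\<^bsub>?E\<^esub>"
    from c obtain s s' where s: "s \<in> carrier S" "s' \<in> carrier S"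
      and c_eq: "c = ((\<zero>\<^bsub>R\<^esub>, \<zero>\<^bsub>M\<^esub>, s), (\<zero>\<^bsub>R\<^esub>, \<zero>\<^bsub>M\<^esub>, s'))"
      by (auto simp: defs sm)
    have "x \<triangleleft>\<^bsub>M\<^esub> s = \<zero>\<^bsub>M\<^esub> \<and> x \<triangleleft>\<^bsub>M\<^esub> s' = \<zero>\<^bsub>M\<^esub>" if x: "x \<in> carrier M" for x
      using ann[OF offdiag[OF x]] x s by (simp add: c_eq defs sm)
    then have "s = \<zero>\<^bsub>S\<^esub>" "s' = \<zero>\<^bsub>S\<^esub>"
      using assms(5) s unfolding right_faithful_def by blast+
    then show "c = \<zero>\<^bsub>?E\<^esub>"
      by (simp add: c_eq defs)
  next
    fix x assume "x \<in> carrier ?E"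
    then show "?f \<otimes>\<^bsub>?E\<^esub> (x \<otimes>\<^bsub>?E\<^esub> ?e) = \<zero>\<^bsub>?E\<^esub>"
      by (auto simp: defs sm)
  qed (simp_all add: defs sm)
qed

end

theorem corollary4p3:
  fixes R :: "('a, 'x) ring_scheme"
    and S :: "('b, 'y) ring_scheme"
    and M :: "('a, 'b, 'c, 'z) bimodule_scheme"
  assumes "ring R" and "ring S"
    and "two_torsion_free R" and "two_torsion_free S"
    and "bimodule R S M"
    and "two_torsion_free M"
    and "left_faithful R M" and "right_faithful S M"
  defines "T \<equiv> Tri R M S"
  defines "E \<equiv> trivial_extension T (regular_bimodule T)"
  shows "\<forall>\<delta>. jordan_derivation E \<delta> \<longrightarrow> derivation E \<delta>"
proof -
  interpret triangular_idempotent E "((\<one>\<^bsub>R\<^esub>, \<zero>\<^bsub>M\<^esub>, \<zero>\<^bsub>S\<^esub>), \<zero>\<^bsub>T\<^esub>)" "((\<zero>\<^bsub>R\<^esub>, \<zero>\<^bsub>M\<^esub>, \<one>\<^bsub>S\<^esub>), \<zero>\<^bsub>T\<^esub>)"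
    unfolding E_def T_def
    by (rule bimodule.triangular_idempotent_trivial_extension) fact+
  show ?thesis
    by (intro allI impI jordan_derivation_imp_derivation)
qed

end
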